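(* Let $A,B\in\mathbb{C}[t]$ with $A\not\equiv 0$, let $n=\deg(A)$, and consider the Abel equation $x'=A(t)x^3+B(t)x^2$. If $n$ is even, or if $\deg(B)>(n-1)/2$, then the equation has at most two invariant curves. In any other case (that is, $n$ odd and $\deg(B)\le (n-1)/2$), the number of invariant curves of the equation is at most $\binom{n}{(n+1)/2}+1$.
   Context: An invariant curve of $x'=A(t)x^3+B(t)x^2$ means here a curve $1+p(t)x=0$ with $p\in\mathbb{C}[t]$ non-constant, such that $f(t,x)=1+p(t)x$ satisfies $\frac{\partial f}{\partial t}+(A(t)x^3+B(t)x^2)\frac{\partial f}{\partial x}=K(t,x)f(t,x)$ for some $K\in\mathbb{C}[t,x]$ (equivalently, $x(t)=-1/p(t)$ is a rational solution). Different polynomials $p$ give different invariant curves; the curve $x=0$ is not counted. The degree of the zero polynomial is $-\infty$. *)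

theory Defs
  imports Complex_Main "HOL-Computational_Algebra.Polynomial"
begin

text \<open>
  The ring of polynomials in \<open>t\<close> and \<open>x\<close> with complex coefficients is rendered as
  \<^typ>\<open>complex poly poly\<close>: the outer indeterminate is \<open>x\<close>, the coefficients are
  polynomials in \<open>t\<close>.  Hence \<open>\<partial>/\<partial>x\<close> is \<^const>\<open>pderiv\<close> and \<open>\<partial>/\<partial>t\<close> is
  \<open>map_poly pderiv\<close>, the coefficientwise derivative.
\<close>

definition abel_rhs :: "complex poly \<Rightarrow> complex poly \<Rightarrow> complex poly poly" where
  "abel_rhs A B = [:0, 0, B, A:]"

definition curve_poly :: "complex poly \<Rightarrow> complex poly poly" where
  "curve_poly p = [:1, p:]"

text \<open>
  A curve \<open>1 + p(t) x = 0\<close> is identified with the polynomial \<open>p\<close>; different \<open>p\<close> are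
  different curves, so counting curves means counting such \<open>p\<close>.
\<close>

definition invariant_curve :: "complex poly \<Rightarrow> complex poly \<Rightarrow> complex poly \<Rightarrow> bool" where
  "invariant_curve A B p \<longleftrightarrow>
     degree p > 0 \<and>
     (\<exists>K :: complex poly poly.
        map_poly pderiv (curve_poly p) + abel_rhs A B * pderiv (curve_poly p)
          = K * curve_poly p)"

end

theory Submission
  imports Defs "HOL-Computational_Algebra.Fundamental_Theorem_Algebra"
    "HOL-Computational_Algebra.Polynomial_Factorial"
begin

text \<open>
  Since \<open>x = -1/p\<close> solves the equation, \<open>p\<close> satisfies \<open>A = p (B - p')\<close>.  Comparing degrees,
  either \<open>n \<le> 2 deg B\<close> and \<open>p\<close> has degree at most \<open>deg B\<close> or degree \<open>deg B + 1\<close> with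
  prescribed leading coefficient, or \<open>n\<close> is odd and \<open>deg p = (n + 1)/2\<close>.  Two solutions satisfy
  \<open>2 (p - q) B = ((p - q) (p + q))'\<close>, and leading terms show that in the first situation each
  of the two types contains at most one solution.

  In the second situation \<open>p\<close> is a multiple of one of the at most \<open>n choose (n + 1)/2\<close> monic
  divisors \<open>g\<close> of \<open>A\<close> of degree \<open>(n + 1)/2\<close>.  If \<open>c g\<close> and \<open>d g\<close> are distinct solutions, then
  \<open>B = (c + d) g'\<close> and \<open>A = c d g g'\<close>.  The first equation excludes a third multiple of \<open>g\<close>;
  the second determines \<open>(g\<^sup>2)'\<close>, hence \<open>g\<close>, so only one \<open>g\<close> can carry two solutions.
\<close>

section \<open>From invariant curves to a polynomial identity in \<open>t\<close>\<close>

lemma invariant_curve_factor: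
  assumes "invariant_curve A B p"
  shows "degree p > 0" "A = p * (B - pderiv p)"
proof -
  show pos: "degree p > 0" using assms by (simp add: invariant_curve_def)
  then have p0: "p \<noteq> 0" by auto
  from assms obtain K where
    "map_poly pderiv (curve_poly p) + abel_rhs A B * pderiv (curve_poly p) = K * curve_poly p"
    by (auto simp: invariant_curve_def)
  then have eq: "[:0, pderiv p, B * p, A * p:] = K * [:1, p:]"
    by (simp add: curve_poly_def abel_rhs_def pderiv_pCons map_poly_pCons mult.commute)
  \<comment> \<open>The product has \<open>x\<close>-degree at most 3 and \<open>[:1, p:]\<close>
    has \<open>x\<close>-degree 1, so the cofactor has \<open>x\<close>-degree at most 2.\<close>
  have "degree (K * [:1, p:]) \<le> 3" unfolding eq[symmetric] by (simp add: degree_pCons_eq_if)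
  moreover have "degree (K * [:1, p:]) = degree K + 1" if "K \<noteq> 0"
    using that p0 by (subst degree_mult_eq) auto
  ultimately have K3: "coeff K 3 = 0" by (cases "K = 0") (auto intro: coeff_eq_0)
  have c: "coeff (K * [:1, p:]) (Suc i) = coeff K (Suc i) + p * coeff K i" for i
    by (simp add: mult.commute[of K] coeff_pCons)
  have c0: "coeff (K * [:1, p:]) 0 = coeff K 0"
    by (simp add: mult.commute[of K] coeff_pCons)
  \<comment> \<open>Comparing the powers of \<open>x\<close> determines the cofactor as
    \<open>p' x + A x^2\<close>; the coefficient of \<open>x^2\<close> then gives the factorization
    of \<open>A\<close>.\<close>
  have "pderiv p = coeff K 1" "B * p = coeff K 2 + p * coeff K 1" "A * p = p * coeff K 2"
    using c0 c[of 0] c[of 1] c[of 2] K3 unfolding eq[symmetric]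
    by (simp_all add: numeral_2_eq_2 numeral_3_eq_3 del: mult_cancel_left mult_cancel_right)
  then show "A = p * (B - pderiv p)"
    using p0 by (simp add: algebra_simps)
qed

section \<open>Degrees and leading terms of solutions\<close>

lemma smult_2: "smult 2 p = 2 * (p :: 'a :: comm_ring_1 poly)"
  using smult_add_left[of 1 1 p] by simp

text \<open>Subtracting the two factorizations gives \<open>(p - q) B = p p' - q q'\<close>, half
  the derivative of \<open>p^2 - q^2\<close>. The factored form allows comparing degrees through
  \<open>p - q\<close> and \<open>p + q\<close>.\<close>

lemma difference_identity:
  fixes p q B :: "'a :: idom poly"
  assumes "p * (B - pderiv p) = q * (B - pderiv q)"
  shows "smult 2 ((p - q) * B) = pderiv ((p - q) * (p + q))"
proof -
  have "(p - q) * B = p * pderiv p - q * pderiv q"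
    using assms by (simp add: algebra_simps)
  then have "smult 2 ((p - q) * B) = 2 * (p * pderiv p - q * pderiv q)"
    by (simp only: smult_2)
  also have "\<dots> = pderiv ((p - q) * (p + q))"
    by (simp add: pderiv_mult pderiv_diff pderiv_add algebra_simps)
  finally show ?thesis .
qed

text \<open>For distinct solutions the left side of the difference identity has degree
  \<open>deg (p - q) + deg B\<close>, but the derivative on the right has smaller degree because
  \<open>deg (p + q)\<close> is at most \<open>deg B\<close>.\<close>

lemma degree_le_unique:
  fixes p q B :: "'a :: field_char_0 poly"
  assumes "p * (B - pderiv p) = q * (B - pderiv q)"
    and "B \<noteq> 0" "degree p \<le> degree B" "degree q \<le> degree B"
  shows "p = q"
proof (rule ccontr)
  assume "p \<noteq> q"
  let ?r = "p - q" and ?s = "p + q"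
  have id: "smult 2 (?r * B) = pderiv (?r * ?s)"
    using assms(1) by (rule difference_identity)
  have nz: "smult 2 (?r * B) \<noteq> 0" using \<open>p \<noteq> q\<close> assms(2) by simp
  have "degree ?r + degree B = degree (smult 2 (?r * B))"
    using \<open>p \<noteq> q\<close> assms(2) by (simp add: degree_mult_eq)
  also have "\<dots> = degree (?r * ?s) - 1" by (simp add: id degree_pderiv)
  finally have "degree ?r + degree B = degree (?r * ?s) - 1" .
  \<comment> \<open>This excludes the truncated value \<open>0 - 1 = 0\<close> in the degree of the
    derivative.\<close>
  moreover have "degree (?r * ?s) \<noteq> 0" using nz by (auto simp: id pderiv_eq_0_iff)
  moreover have "degree (?r * ?s) \<le> degree ?r + degree ?s" by (rule degree_mult_le)
  moreover have "degree ?s \<le> degree B" using assms by (simp add: degree_add_le)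
  ultimately show False by linarith
qed

text \<open>With \<open>b = deg B\<close>, the sum \<open>p + q\<close> has degree
  \<open>b + 1\<close> and leading coefficient \<open>2 lc(B) / (b + 1)\<close>. Leading
  coefficients in the difference identity then give
  \<open>b + 1 = deg (p - q) + b + 1\<close>.\<close>

lemma leading_cancellation_unique:
  fixes p q B :: "'a :: field_char_0 poly"
  assumes eq: "p * (B - pderiv p) = q * (B - pderiv q)"
    and nz: "p * (B - pderiv p) \<noteq> 0" and "B \<noteq> 0"
    and deg: "degree p = Suc (degree B)" "degree q = Suc (degree B)"
    and lc: "of_nat (degree p) * lead_coeff p = lead_coeff B"
      "of_nat (degree q) * lead_coeff q = lead_coeff B"
  shows "p = q"
proof (rule ccontr)
  assume "p \<noteq> q"
  let ?r = "p - q" and ?s = "p + q" and ?b = "degree B"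
  have id: "smult 2 (?r * B) = pderiv (?r * ?s)" using eq by (rule difference_identity)
  have s: "of_nat (Suc ?b) * coeff ?s (Suc ?b) = 2 * lead_coeff B"
    using lc deg by (simp add: algebra_simps)
  have "coeff ?s (Suc ?b) \<noteq> 0" using s \<open>B \<noteq> 0\<close> by auto
  moreover have "degree ?s \<le> Suc ?b" using deg by (simp add: degree_add_le)
  ultimately have ds: "degree ?s = Suc ?b" by (simp add: le_antisym le_degree)
  have "2 * (lead_coeff ?r * lead_coeff B) = coeff (smult 2 (?r * B)) (degree ?r + ?b)"
    by (simp only: coeff_smult coeff_mult_degree_sum)
  also have "\<dots> = coeff (pderiv (?r * ?s)) (degree ?r + ?b)"
    by (simp only: id)
  also have "\<dots> = of_nat (Suc (degree ?r + ?b)) * (lead_coeff ?r * coeff ?s (Suc ?b))"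
    using coeff_mult_degree_sum[of ?r ?s] by (simp only: coeff_pderiv ds add_Suc_right)
  finally have "2 * (lead_coeff ?r * lead_coeff B)
      = of_nat (Suc (degree ?r + ?b)) * (lead_coeff ?r * coeff ?s (Suc ?b))"
    .
  then have "lead_coeff ?r * (of_nat (Suc ?b) * coeff ?s (Suc ?b))
      = lead_coeff ?r * (of_nat (Suc (degree ?r + ?b)) * coeff ?s (Suc ?b))"
    unfolding s by (simp only: mult_ac)
  moreover have "lead_coeff ?r \<noteq> 0"
    using \<open>p \<noteq> q\<close> by (simp only: leading_coeff_0_iff right_minus_eq not_False_eq_True)
  ultimately have "of_nat (Suc ?b) = (of_nat (Suc (degree ?r + ?b)) :: 'a)"
    using \<open>coeff ?s (Suc ?b) \<noteq> 0\<close> by (simp only: mult_cancel_left mult_cancel_right) simp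
  then have "degree ?r = 0" by (simp only: of_nat_eq_iff)
  \<comment> \<open>The solutions differ by a constant, so both have the same nonzero second factor
    \<open>B - p'\<close>, which can be cancelled.\<close>
  then have "pderiv ?r = 0" by (simp add: pderiv_eq_0_iff)
  then have pq: "pderiv q = pderiv p" by (simp add: pderiv_diff)
  have "?r * (B - pderiv p) = 0" using eq pq by (simp add: algebra_simps)
  with nz \<open>p \<noteq> q\<close> show False by simp
qed

text \<open>The cases record which of \<open>B\<close> and \<open>p'\<close> dominates in
  \<open>B - p'\<close> and, at equal degree, whether the leading terms cancel. In
  \<open>high\<close> and \<open>cancel\<close> the product has degree at most
  \<open>2 deg B\<close>; in \<open>low\<close> and \<open>equal\<close> its degree is the odd
  number \<open>2 deg p - 1\<close>.\<close>

lemma degree_cases: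
  fixes p B :: "'a :: field_char_0 poly"
  assumes "degree p > 0" and nz: "p * (B - pderiv p) \<noteq> 0"
  obtains (high) "B \<noteq> 0" "degree p \<le> degree B"
      "degree (p * (B - pderiv p)) = degree p + degree B"
    | (low) "B = 0 \<or> degree B + 1 < degree p" "degree (p * (B - pderiv p)) + 1 = 2 * degree p"
    | (cancel) "B \<noteq> 0" "degree p = Suc (degree B)"
      "degree (p * (B - pderiv p)) \<le> 2 * degree B"
      "of_nat (degree p) * lead_coeff p = lead_coeff B"
    | (equal) "B \<noteq> 0" "degree p = Suc (degree B)"
      "degree (p * (B - pderiv p)) + 1 = 2 * degree p"
proof -
  have dm: "degree (p * (B - pderiv p)) = degree p + degree (B - pderiv p)"
    using nz by (intro degree_mult_eq) auto
  have dp: "degree (pderiv p) = degree p - 1" by (rule degree_pderiv)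
  consider "B \<noteq> 0" "degree p \<le> degree B" | "B = 0 \<or> degree B + 1 < degree p"
    | "B \<noteq> 0" "degree p = Suc (degree B)" by linarith
  then show ?thesis
  proof cases
    case 1
    then have "degree (B - pderiv p) = degree B"
      using assms(1) dp by (simp add: diff_conv_add_uminus degree_add_eq_left del: add_uminus_conv_diff)
    with 1 dm show ?thesis by (intro high) auto
  next
    case 2
    then have "degree (B - pderiv p) = degree p - 1"
      using assms(1) dp degree_add_eq_right[of B "- pderiv p"] by auto
    with 2 dm assms(1) show ?thesis by (intro low) auto
  next
    case 3
    then have c: "coeff (pderiv p) (degree B) = of_nat (degree p) * lead_coeff p"
      by (simp add: coeff_pderiv)
    have le: "degree (B - pderiv p) \<le> degree B" using 3 dp by (simp add: degree_diff_le)
    show ?thesis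
    proof (cases "degree (B - pderiv p) = degree B")
      case True
      with 3 dm show ?thesis by (intro equal) auto
    next
      case False
      \<comment> \<open>The strict drop bounds the degree of the product by
        \<open>(b + 1) + (b - 1) = 2 b\<close>, where \<open>b = deg B\<close>.\<close>
      with le have l: "degree (B - pderiv p) < degree B" by simp
      then have "coeff (B - pderiv p) (degree B) = 0" by (rule coeff_eq_0)
      with 3 dm l c show ?thesis by (intro cancel) auto
    qed
  qed
qed

section \<open>Monic divisors of a given degree\<close>

lemma monic_dvd_prod_linear:
  fixes r :: "'a \<Rightarrow> 'b :: field"
  assumes "finite I" "lead_coeff p = 1" "p dvd (\<Prod>i\<in>I. [:- r i, 1:])"
  shows "\<exists>J\<subseteq>I. p = (\<Prod>i\<in>J. [:- r i, 1:])"
  using assms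
proof (induction I arbitrary: p rule: finite_induct)
  case empty
  then have "is_unit p" by simp
  then obtain c where "p = [:c:]" by (auto simp: is_unit_poly_iff)
  with empty show ?case by (auto simp: one_pCons)
next
  case (insert i I)
  let ?l = "[:- r i, 1:]"
  have d: "p dvd ?l * (\<Prod>i\<in>I. [:- r i, 1:])" using insert by simp
  have prime: "prime_elem ?l" by (rule prime_elem_linear_field_poly) simp
  \<comment> \<open>The prime \<open>?l\<close> divides either \<open>p\<close>, and is cancelled
    from \<open>p\<close> and the product, or the cofactor \<open>k\<close>, and then
    \<open>p\<close> divides the product over \<open>I\<close> alone.\<close>
  show ?case
  proof (cases "?l dvd p")
    case True
    then obtain q where q: "p = ?l * q" by blast
    have "?l \<noteq> 0" by simp
    then have "q dvd (\<Prod>i\<in>I. [:- r i, 1:])" using d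
      unfolding q dvd_mult_cancel_left by blast
    moreover have "lead_coeff q = 1" using insert.prems(1) unfolding q lead_coeff_mult by simp
    ultimately obtain J where J: "J \<subseteq> I" "q = (\<Prod>i\<in>J. [:- r i, 1:])"
      using insert.IH by blast
    have "p = (\<Prod>i\<in>insert i J. [:- r i, 1:])"
      using J insert.hyps q by (subst prod.insert) (auto intro: finite_subset)
    with J show ?thesis by (intro exI[of _ "insert i J"]) auto
  next
    case False
    obtain k where k: "?l * (\<Prod>i\<in>I. [:- r i, 1:]) = p * k" using d by blast
    then have "?l dvd p * k" by (metis dvd_triv_left)
    with False prime obtain k' where "k = ?l * k'" by (auto simp: prime_elem_dvd_mult_iff)
    then have "?l * (\<Prod>i\<in>I. [:- r i, 1:]) = ?l * (p * k')" using k by (simp only: mult_ac)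
    then have "(\<Prod>i\<in>I. [:- r i, 1:]) = p * k'" by (subst (asm) mult_cancel_left) simp
    then have "p dvd (\<Prod>i\<in>I. [:- r i, 1:])" by simp
    then show ?thesis using insert by blast
  qed
qed

lemma monic_normalization:
  fixes p :: "'a :: field poly"
  assumes "p \<noteq> 0"
  defines "g \<equiv> smult (inverse (lead_coeff p)) p"
  shows "lead_coeff g = 1" "degree g = degree p" "g dvd q \<longleftrightarrow> p dvd q"
  using assms by (auto simp: smult_dvd_iff)

text \<open>Roots are listed with multiplicity, and a monic divisor of degree \<open>m\<close> is
  the product over some \<open>m\<close> positions of the list. Repeated roots may give the same
  divisor for several choices, hence only an inequality.\<close>

lemma card_monic_divisors_le:
  fixes A :: "'a :: alg_closed_field poly"
  assumes "A \<noteq> 0"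
  defines "D m \<equiv> {g. lead_coeff g = 1 \<and> degree g = m \<and> g dvd A}"
  shows "finite (D m) \<and> card (D m) \<le> degree A choose m"
proof -
  obtain M where M: "size M = degree A" "A = smult (lead_coeff A) (\<Prod>x\<in>#M. [:- x, 1:])"
    using alg_closed_imp_factorization[OF assms(1)] by blast
  obtain xs where mset: "mset xs = M" using ex_mset by blast
  have xs: "length xs = degree A" using M(1) mset size_mset by metis
  let ?I = "{..<degree A}"
  let ?P = "\<lambda>J. \<Prod>i\<in>J. [:- (xs ! i), 1:]"
  have A: "A = smult (lead_coeff A) (?P ?I)"
  proof -
    have "(\<Prod>x\<in>#M. [:- x, 1:]) = (\<Prod>x\<leftarrow>xs. [:- x, 1:])"
      unfolding mset[symmetric] by (simp add: prod_mset_prod_list flip: mset_map)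
    also have "\<dots> = ?P ?I" by (simp add: prod.list_conv_set_nth xs lessThan_atLeast0)
    finally show ?thesis using M(2) by simp
  qed
  have sub: "D m \<subseteq> ?P ` {J. J \<subseteq> ?I \<and> card J = m}"
  proof
    fix g assume "g \<in> D m"
    then have g: "lead_coeff g = 1" "degree g = m" "g dvd A" by (auto simp: D_def)
    have "g dvd smult (lead_coeff A) (?P ?I)" using g(3) A by metis
    then have "g dvd ?P ?I" using assms(1) by (simp add: dvd_smult_iff)
    then obtain J where J: "J \<subseteq> ?I" "g = ?P J"
      using monic_dvd_prod_linear[OF _ g(1)] by blast
    have "degree (?P J) = card J" by (subst degree_prod_eq_sum_degree) auto
    with J g(2) have "J \<in> {J. J \<subseteq> ?I \<and> card J = m}" by simp
    then show "g \<in> ?P ` {J. J \<subseteq> ?I \<and> card J = m}" unfolding J(2) by (rule imageI)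
  qed
  have fin: "finite {J. J \<subseteq> ?I \<and> card J = m}" by (rule finite_subset[of _ "Pow ?I"]) auto
  have "card {J. J \<subseteq> ?I \<and> card J = m} = degree A choose m" by (subst n_subsets) auto
  then show ?thesis
    using surj_card_le[OF fin sub] finite_subset[OF sub] fin by auto
qed

section \<open>Solutions proportional to one polynomial\<close>

lemma proportional_solutions:
  fixes g B :: "'a :: idom poly"
  assumes eq: "smult c g * (B - pderiv (smult c g)) = smult d g * (B - pderiv (smult d g))"
    and "g \<noteq> 0" "c \<noteq> d"
  shows "B = smult (c + d) (pderiv g)"
    and "smult c g * (B - pderiv (smult c g)) = smult (c * d) (g * pderiv g)"
proof -
  have "g * (smult c B - smult (c * c) (pderiv g)) = g * (smult d B - smult (d * d) (pderiv g))"
    using eq by (simp add: pderiv_smult smult_diff_right algebra_simps)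
  then have "smult c B - smult (c * c) (pderiv g) = smult d B - smult (d * d) (pderiv g)"
    using \<open>g \<noteq> 0\<close> by simp
  \<comment> \<open>Since \<open>c^2 - d^2 = (c - d) (c + d)\<close>, the nonzero factor
    \<open>c - d\<close> cancels. Then \<open>B - c g' = d g'\<close> gives the second
    claim.\<close>
  then have "smult (c - d) B = smult (c * c - d * d) (pderiv g)"
    by (simp add: smult_diff_left algebra_simps)
  also have "\<dots> = smult (c - d) (smult (c + d) (pderiv g))"
    by (simp add: algebra_simps)
  finally show B: "B = smult (c + d) (pderiv g)"
    using \<open>c \<noteq> d\<close> by (auto intro: smult_cancel[of "c - d", rotated])
  show "smult c g * (B - pderiv (smult c g)) = smult (c * d) (g * pderiv g)"
    unfolding B by (simp add: pderiv_smult smult_add_left mult.commute)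
qed

lemma lead_coeff_pderiv:
  fixes p :: "'a :: {comm_semiring_1,semiring_no_zero_divisors,semiring_char_0} poly"
  shows "lead_coeff (pderiv p) = of_nat (degree p) * lead_coeff p"
proof (cases "degree p = 0")
  case True
  then have "pderiv p = 0" by (simp add: pderiv_eq_0_iff)
  with True show ?thesis by simp
next
  case False
  then show ?thesis by (simp add: degree_pderiv coeff_pderiv)
qed

text \<open>The derivative of \<open>g^2 - h^2\<close> vanishes, so \<open>(g - h) (g + h)\<close>
  is constant; \<open>g + h\<close> has leading coefficient 2 and positive degree, so
  \<open>g - h\<close> must vanish.\<close>

lemma monic_mult_pderiv_inj:
  fixes g h :: "'a :: field_char_0 poly"
  assumes "lead_coeff g = 1" "lead_coeff h = 1" "degree g = degree h" "degree g > 0"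
    and eq: "g * pderiv g = h * pderiv h"
  shows "g = h"
proof (rule ccontr)
  assume "g \<noteq> h"
  have "pderiv ((g - h) * (g + h)) = smult 2 (g * pderiv g - h * pderiv h)"
    by (simp add: smult_2 pderiv_mult pderiv_diff pderiv_add algebra_simps)
  then have "degree ((g - h) * (g + h)) = 0" using eq by (simp add: pderiv_eq_0_iff)
  moreover have "coeff (g + h) (degree g) = 2" using assms by simp
  then have "degree (g + h) \<ge> degree g" by (intro le_degree) simp
  moreover have "g + h \<noteq> 0" using \<open>coeff (g + h) (degree g) = 2\<close> by force
  ultimately show False using \<open>g \<noteq> h\<close> assms(4) by (simp add: degree_mult_eq)
qed

section \<open>Counting the invariant curves\<close>

theorem theorem2p12:
  fixes A B :: "complex poly" and n :: nat
  assumes "A \<noteq> 0" and "n = degree A"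
  shows "(even n \<or> (B \<noteq> 0 \<and> real (degree B) > (real n - 1) / 2) \<longrightarrow>
            finite {p. invariant_curve A B p} \<and> card {p. invariant_curve A B p} \<le> 2) \<and>
         (odd n \<and> (B = 0 \<or> real (degree B) \<le> (real n - 1) / 2) \<longrightarrow>
            finite {p. invariant_curve A B p} \<and>
            card {p. invariant_curve A B p} \<le> (n choose ((n + 1) div 2)) + 1)"
proof (intro conjI[of "_ \<longrightarrow> _"] impI)
  let ?S = "{p. invariant_curve A B p}" and ?b = "degree B"
  have S: "degree p > 0" "A = p * (B - pderiv p)" if "p \<in> ?S" for p
    using that invariant_curve_factor[of A B p] by auto
  have eq: "p * (B - pderiv p) = q * (B - pderiv q)" if "p \<in> ?S" "q \<in> ?S" for p q
    using that S by metis
  have nzS: "p * (B - pderiv p) \<noteq> 0" if "p \<in> ?S" for p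
    using S(2)[OF that] assms(1) by auto
  have dA: "degree (p * (B - pderiv p)) = n" if "p \<in> ?S" for p
    using S(2)[OF that] assms(2) by auto
  {
    assume case1: "even n \<or> (B \<noteq> 0 \<and> real ?b > (real n - 1) / 2)"
    \<comment> \<open>A solution of type \<open>low\<close> or \<open>equal\<close> makes
      \<open>n\<close> odd, so the bound on \<open>deg B\<close> must be the alternative that holds;
      over the integers it reads \<open>n \<le> 2 * ?b\<close>.\<close>
    have n: "B \<noteq> 0 \<and> n \<le> 2 * ?b" if "p \<in> ?S" for p
    proof -
      have *: "even n \<or> (B \<noteq> 0 \<and> n \<le> 2 * ?b)" using case1 by (auto simp: field_simps)
      show ?thesis using S(1)[OF that] nzS[OF that]
      proof (cases rule: degree_cases)
        case high
        then show ?thesis using dA[OF that] by simp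
      next
        case low
        then have "Suc n = 2 * degree p" using dA[OF that] by simp
        then have "odd n" by presburger
        with * show ?thesis by blast
      next
        case cancel
        then show ?thesis using dA[OF that] by simp
      next
        case equal
        then have "Suc n = 2 * degree p" using dA[OF that] by simp
        then have "odd n" by presburger
        with * show ?thesis by blast
      qed
    qed
    let ?L = "{p \<in> ?S. degree p \<le> ?b}" and ?H = "{p \<in> ?S. degree p > ?b}"
    have L: "p = q" if "p \<in> ?L" "q \<in> ?L" for p q
    proof -
      have "p \<in> ?S" "q \<in> ?S" "degree p \<le> ?b" "degree q \<le> ?b" using that by auto
      then show ?thesis using degree_le_unique[OF eq] n by blast
    qed
    \<comment> \<open>Types \<open>low\<close> and \<open>equal\<close> would give
      \<open>n + 1 = 2 deg p \<ge> 2 ?b + 2\<close>, against \<open>n \<le> 2 * ?b\<close>; only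
      cancellation of leading terms remains.\<close>
    have high_deg: "degree p = Suc ?b \<and> of_nat (degree p) * lead_coeff p = lead_coeff B"
      if "p \<in> ?H" for p
    proof -
      have p: "p \<in> ?S" "degree p > ?b" using that by auto
      show ?thesis using S(1)[OF p(1)] nzS[OF p(1)]
        by (cases rule: degree_cases) (use p dA[OF p(1)] n[OF p(1)] in auto)
    qed
    have H: "p = q" if "p \<in> ?H" "q \<in> ?H" for p q
    proof -
      have "p \<in> ?S" "q \<in> ?S" using that by auto
      then show ?thesis
        using leading_cancellation_unique[OF eq nzS] n high_deg[OF that(1)] high_deg[OF that(2)]
        by blast
    qed
    have one: "finite X \<and> card X \<le> 1" if "\<And>p q. p \<in> X \<Longrightarrow> q \<in> X \<Longrightarrow> p = q"
      for X :: "complex poly set"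
    proof -
      have "X = {} \<or> (\<exists>x. X = {x})" using that by blast
      then show ?thesis by auto
    qed
    have "?S = ?L \<union> ?H" by auto
    moreover have "finite ?L \<and> card ?L \<le> 1" "finite ?H \<and> card ?H \<le> 1"
      using L H by (blast intro!: one)+
    ultimately show "finite ?S \<and> card ?S \<le> 2"
      using card_Un_le[of ?L ?H] by (metis (no_types, lifting) add_mono finite_UnI le_trans one_add_one)
  next
    assume case2: "odd n \<and> (B = 0 \<or> real ?b \<le> (real n - 1) / 2)"
    let ?m = "(n + 1) div 2"
    let ?N = "\<lambda>p :: complex poly. smult (inverse (lead_coeff p)) p"
    let ?D = "{g. lead_coeff g = 1 \<and> degree g = ?m \<and> g dvd A}"
    have b: "B = 0 \<or> 2 * ?b + 1 \<le> n" using case2 by (auto simp: field_simps)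
    \<comment> \<open>Types \<open>high\<close> and \<open>cancel\<close> need
      \<open>n \<le> 2 * ?b\<close>, which \<open>b\<close> excludes; the other two give
      \<open>n + 1 = 2 deg p\<close>.\<close>
    have deg: "degree p = ?m" if "p \<in> ?S" for p
      using S(1)[OF that] nzS[OF that]
      by (cases rule: degree_cases) (use dA[OF that] b S(1)[OF that] in auto)
    have nz: "p \<noteq> 0" if "p \<in> ?S" for p using S(1)[OF that] by auto
    have N: "smult (lead_coeff p) (?N p) = p" if "p \<in> ?S" for p using nz[OF that] by simp
    have ND: "?N ` ?S \<subseteq> ?D"
    proof
      fix g assume "g \<in> ?N ` ?S"
      then obtain p where p: "p \<in> ?S" "g = ?N p" by blast
      have "p dvd A" using S(2)[OF p(1)] by (metis dvd_triv_left)
      then show "g \<in> ?D"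
        using monic_normalization[OF nz[OF p(1)]] deg[OF p(1)] unfolding p(2) by (metis (mono_tags, lifting) mem_Collect_eq)
    qed
    have D: "finite ?D" "card ?D \<le> n choose ?m"
      using card_monic_divisors_le[OF assms(1), of ?m] assms(2) by auto
    have bound: "finite X \<and> card X \<le> n choose ?m" if "X \<subseteq> ?S" "inj_on ?N X" for X
    proof -
      have "?N ` X \<subseteq> ?D" using that ND by blast
      then show ?thesis
        using D that inj_on_finite[of ?N X ?D] card_inj_on_le[of ?N X ?D] by force
    qed
    have pair: "B = smult (lead_coeff p + lead_coeff q) (pderiv (?N p))"
      "A = smult (lead_coeff p * lead_coeff q) (?N p * pderiv (?N p))"
      if "p \<in> ?S" "q \<in> ?S" "?N p = ?N q" "p \<noteq> q" for p q
    proof -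
      define g where "g = ?N p"
      have pg: "smult (lead_coeff p) g = p" unfolding g_def by (rule N[OF that(1)])
      have qg: "smult (lead_coeff q) g = q" unfolding g_def that(3) by (rule N[OF that(2)])
      have "g \<noteq> 0" using nz[OF that(1)] pg by auto
      moreover have "lead_coeff p \<noteq> lead_coeff q" using pg qg that(4) by metis
      moreover have "smult (lead_coeff p) g * (B - pderiv (smult (lead_coeff p) g))
          = smult (lead_coeff q) g * (B - pderiv (smult (lead_coeff q) g))"
        unfolding pg qg by (rule eq[OF that(1,2)])
      ultimately have B: "B = smult (lead_coeff p + lead_coeff q) (pderiv g)"
        and "p * (B - pderiv p) = smult (lead_coeff p * lead_coeff q) (g * pderiv g)"
        using proportional_solutions[of "lead_coeff p" g B "lead_coeff q"] unfolding pg by blast+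
      then show "A = smult (lead_coeff p * lead_coeff q) (?N p * pderiv (?N p))"
        unfolding S(2)[OF that(1), symmetric] g_def by blast
      show "B = smult (lead_coeff p + lead_coeff q) (pderiv (?N p))"
        using B unfolding g_def .
    qed
    show "finite ?S \<and> card ?S \<le> (n choose ?m) + 1"
    proof (cases "inj_on ?N ?S")
      case True
      then show ?thesis using bound[of ?S] by auto
    next
      case False
      then obtain p q where pq: "p \<in> ?S" "q \<in> ?S" "?N p = ?N q" "p \<noteq> q"
        unfolding inj_on_def by blast
      \<comment> \<open>Dropping one member of a colliding pair must remove every collision: another
        pair \<open>u\<close>, \<open>v\<close> would share the normalization of \<open>p\<close>,
        giving three solutions that are multiples of one polynomial.\<close>
      have "inj_on ?N (?S - {p})"
      proof (rule inj_onI, rule ccontr)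
        fix u v assume "u \<in> ?S - {p}" "v \<in> ?S - {p}" and uv: "?N u = ?N v" "u \<noteq> v"
        then have us: "u \<in> ?S" "v \<in> ?S" "u \<noteq> p" "v \<noteq> p" by auto
        define g h where "g = ?N p" and "h = ?N u"
        have gD: "lead_coeff g = 1" "degree g = ?m" and hD: "lead_coeff h = 1" "degree h = ?m"
          using ND pq(1) us(1) unfolding g_def h_def by blast+
        have m: "?m > 0" using S(1)[OF pq(1)] deg[OF pq(1)] by (simp only:)
        have lc: "lead_coeff (smult c (f * pderiv f)) = c * of_nat ?m"
          if "lead_coeff f = 1" "degree f = ?m" for c and f :: "complex poly"
        proof -
          have "lead_coeff (pderiv f) = of_nat ?m"
            using that by (simp add: lead_coeff_pderiv)
          then show ?thesis using that(1) by (simp only: lead_coeff_smult lead_coeff_mult mult_1)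
        qed
        have Ag: "A = smult (lead_coeff p * lead_coeff q) (g * pderiv g)"
          unfolding g_def by (rule pair(2)[OF pq])
        have Ah: "A = smult (lead_coeff u * lead_coeff v) (h * pderiv h)"
          unfolding h_def by (rule pair(2)[OF us(1,2) uv])
        \<comment> \<open>Both \<open>g g'\<close> and \<open>h h'\<close> have leading coefficient
          \<open>?m\<close>, so the scalars in \<open>Ag\<close> and \<open>Ah\<close> agree and can
          be cancelled.\<close>
        have "lead_coeff A = lead_coeff p * lead_coeff q * of_nat ?m"
          using Ag lc[OF gD, of "lead_coeff p * lead_coeff q"] by metis
        moreover have "lead_coeff A = lead_coeff u * lead_coeff v * of_nat ?m"
          using Ah lc[OF hD, of "lead_coeff u * lead_coeff v"] by metis
        ultimately have "lead_coeff p * lead_coeff q * of_nat ?m = lead_coeff u * lead_coeff v * of_nat ?m"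
          by (rule trans[OF sym])
        then have "lead_coeff p * lead_coeff q = lead_coeff u * lead_coeff v"
          using m by (metis mult_cancel_right of_nat_eq_0_iff less_irrefl)
        moreover have "lead_coeff p * lead_coeff q \<noteq> 0" using nz pq by simp
        ultimately have "g * pderiv g = h * pderiv h"
          using trans[OF sym[OF Ag] Ah] by (metis smult_cancel)
        then have gh: "g = h" using monic_mult_pderiv_inj[of g h] gD hD m by metis
        \<comment> \<open>Pairing \<open>p\<close> with \<open>u\<close> and with \<open>v\<close>
          writes \<open>B\<close> as two multiples of the same nonzero \<open>g'\<close>, which
          forces equal leading coefficients and hence \<open>u = v\<close>.\<close>
        have "B = smult (lead_coeff p + lead_coeff u) (pderiv g)"
          "B = smult (lead_coeff p + lead_coeff v) (pderiv g)"
          using pair(1)[of p u] pair(1)[of p v] pq(1) us uv gh unfolding g_def h_def by metis+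
        moreover have "pderiv g \<noteq> 0" using gD m by (metis pderiv_eq_0_iff less_irrefl)
        ultimately have "lead_coeff u = lead_coeff v"
          by (metis add_left_cancel smult_diff_left smult_eq_0_iff eq_iff_diff_eq_0)
        then show False using N[OF us(1)] N[OF us(2)] uv by metis
      qed
      then have "finite (?S - {p})" "card (?S - {p}) \<le> n choose ?m"
        using bound[of "?S - {p}"] by auto
      then show ?thesis using card_Suc_Diff1[of ?S p] pq(1) by auto
    qed
  }
qed

end
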